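(* If $X$ is a symmetric Banach sequence space different from $\ell_1$ and $\gamma$ is a symmetric linear functional on $X$, then $\gamma(e_n)=0$ for every $n\in\mathbb{N}$.
   Context: $\mathbb{K}=\mathbb{R}$ or $\mathbb{C}$, and $\mathbb{K}^{\mathbb{N}}$ is the vector space of all sequences $(x_n)_{n\in\mathbb{N}}$ with $x_n\in\mathbb{K}$. A Banach sequence space is a linear subspace $X$ of $\mathbb{K}^{\mathbb{N}}$ endowed with a complete norm $\|\cdot\|$ such that, if $x=(x_n)_n\in\mathbb{K}^{\mathbb{N}}$ and $y=(y_n)_n\in X$ satisfy $|x_n|\le|y_n|$ for every $n$, then $x\in X$ and $\|x\|\le\|y\|$. Here $e_k$ denotes the $k$-th canonical unit vector ($1$ in position $k$, $0$ elsewhere). Standing assumption: every Banach sequence space contains all the $e_k$, and $\|e_k\|=1$ for all $k\in\mathbb{N}$. $X$ is symmetric if $x_\sigma=(x_{\sigma(n)})_n\in X$ and $\|x_\sigma\|=\|x\|$ for every $x\in X$ and every permutation $\sigma$ of $\mathbb{N}$. A linear functional $\gamma:X\to\mathbb{K}$ is symmetric if $\gamma(x)=\gamma(x_\sigma)$ for every $x\in X$ and every permutation $\sigma$ of $\mathbb{N}$. $\ell_1$ is the space of sequences $(x_n)_n\in\mathbb{K}^{\mathbb{N}}$ with $\sum_n|x_n|<\infty$; "$X$ different from $\ell_1$" is meant as sets of sequences (equality with $\ell_1$ being up to an equivalent norm).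
   Formalization: The linear functional γ is assumed continuous (bounded); for arbitrary linear functionals the claim fails, for example on the Lorentz space d(w,1) with w_n ~ 1/log n, where a Hamel basis gives a discontinuous symmetric γ with γ(e_n)=1. *)

theory Defs
  imports Complex_Main
begin

definition unit_seq :: "nat \<Rightarrow> nat \<Rightarrow> 'a::real_normed_field"
  where "unit_seq k = (\<lambda>n. if n = k then 1 else 0)"

definition ell1 :: "(nat \<Rightarrow> 'a::real_normed_field) set"
  where "ell1 = {x. summable (\<lambda>n. norm (x n))}"

text \<open>
  The scalar type \<^typ>\<open>'a\<close> is meant to be instantiated with \<^typ>\<open>real\<close> or \<^typ>\<open>complex\<close>.
  The function \<open>N\<close> is only constrained on the carrier \<open>X\<close>; its values elsewhere are
  irrelevant. The last two axioms are the standing normalisation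
  that \<open>X\<close> contains every canonical unit vector, each of norm one.
\<close>

locale banach_sequence_space =
  fixes X :: "(nat \<Rightarrow> 'a::real_normed_field) set"
    and N :: "(nat \<Rightarrow> 'a) \<Rightarrow> real"
  assumes zero_mem: "(\<lambda>n. 0) \<in> X"
    and add_mem: "\<And>x y. x \<in> X \<Longrightarrow> y \<in> X \<Longrightarrow> (\<lambda>n. x n + y n) \<in> X"
    and scale_mem: "\<And>c x. x \<in> X \<Longrightarrow> (\<lambda>n. c * x n) \<in> X"
    and norm_nonneg: "\<And>x. x \<in> X \<Longrightarrow> 0 \<le> N x"
    and norm_eq_zero_iff: "\<And>x. x \<in> X \<Longrightarrow> N x = 0 \<longleftrightarrow> x = (\<lambda>n. 0)"
    and norm_scale: "\<And>c x. x \<in> X \<Longrightarrow> N (\<lambda>n. c * x n) = norm c * N x"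
    and norm_triangle: "\<And>x y. x \<in> X \<Longrightarrow> y \<in> X \<Longrightarrow> N (\<lambda>n. x n + y n) \<le> N x + N y"
    and norm_complete:
      "\<And>s. (\<And>i. s i \<in> X) \<Longrightarrow>
        (\<And>\<epsilon>. \<epsilon> > 0 \<Longrightarrow> \<exists>M. \<forall>i\<ge>M. \<forall>j\<ge>M. N (\<lambda>n. s i n - s j n) < \<epsilon>) \<Longrightarrow>
        \<exists>l\<in>X. (\<lambda>i. N (\<lambda>n. s i n - l n)) \<longlonglongrightarrow> 0"
    and solid_mem: "\<And>x y. y \<in> X \<Longrightarrow> (\<And>n. norm (x n) \<le> norm (y n)) \<Longrightarrow> x \<in> X"
    and solid_norm: "\<And>x y. y \<in> X \<Longrightarrow> (\<And>n. norm (x n) \<le> norm (y n)) \<Longrightarrow> N x \<le> N y"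
    and unit_seq_mem: "\<And>k. unit_seq k \<in> X"
    and norm_unit_seq: "\<And>k. N (unit_seq k) = 1"

locale symmetric_banach_sequence_space = banach_sequence_space X N
  for X :: "(nat \<Rightarrow> 'a::real_normed_field) set" and N :: "(nat \<Rightarrow> 'a) \<Rightarrow> real" +
  assumes perm_mem: "\<And>x \<sigma>. x \<in> X \<Longrightarrow> bij \<sigma> \<Longrightarrow> (\<lambda>n. x (\<sigma> n)) \<in> X"
    and norm_perm: "\<And>x \<sigma>. x \<in> X \<Longrightarrow> bij \<sigma> \<Longrightarrow> N (\<lambda>n. x (\<sigma> n)) = N x"

text \<open>
  Functionals on a Banach sequence space are continuous, expressed by boundedness as in
  \<^const>\<open>bounded_linear\<close>. Continuity cannot be dropped: if \<open>X\<close> is the Lorentz space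
  \<open>d(w,1)\<close> with \<open>w n\<close> proportional to \<open>1 / ln (n + 2)\<close>, then \<open>X \<noteq> ell1\<close> and the sequence
  \<open>1 / (n + 1)\<close> is not in \<open>X\<close>; consequently \<open>unit_seq 0\<close> is not a finite sum of differences
  \<open>x - x \<circ> \<sigma>\<close> with \<open>x \<in> X\<close>, and a Hamel basis argument gives a discontinuous symmetric
  linear functional that is \<open>1\<close> on every \<open>unit_seq k\<close>.
\<close>

definition bounded_linear_functional_on ::
    "(nat \<Rightarrow> 'a::real_normed_field) set \<Rightarrow> ((nat \<Rightarrow> 'a) \<Rightarrow> real) \<Rightarrow> ((nat \<Rightarrow> 'a) \<Rightarrow> 'a) \<Rightarrow> bool"
  where "bounded_linear_functional_on X N \<gamma> \<longleftrightarrow>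
    (\<forall>x\<in>X. \<forall>y\<in>X. \<gamma> (\<lambda>n. x n + y n) = \<gamma> x + \<gamma> y) \<and>
    (\<forall>c. \<forall>x\<in>X. \<gamma> (\<lambda>n. c * x n) = c * \<gamma> x) \<and>
    (\<exists>C. \<forall>x\<in>X. norm (\<gamma> x) \<le> N x * C)"

definition symmetric_functional_on ::
    "(nat \<Rightarrow> 'a::real_normed_field) set \<Rightarrow> ((nat \<Rightarrow> 'a) \<Rightarrow> 'a) \<Rightarrow> bool"
  where "symmetric_functional_on X \<gamma> \<longleftrightarrow>
    (\<forall>x\<in>X. \<forall>\<sigma>. bij \<sigma> \<longrightarrow> \<gamma> x = \<gamma> (\<lambda>n. x (\<sigma> n)))"

end

theory Submission
  imports Defs "HOL-Combinatorics.Transposition"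
begin

text \<open>
  A symmetric functional \<open>\<gamma>\<close> takes a single value \<open>c\<close> on all unit sequences, so on a finitely
  supported sequence it is \<open>c\<close> times the sum of the entries. If \<open>c \<noteq> 0\<close>, boundedness of \<open>\<gamma>\<close>
  turns this into a lower bound for the norm: the sum of nonnegative entries is at most a
  constant times the norm. By solidity the moduli of the entries of any \<open>x \<in> X\<close>, truncated to a
  finite set, have norm at most \<open>N x\<close>, so their partial sums are bounded and \<open>X \<subseteq> ell1\<close>
  (\<open>subset_ell1\<close>). The reverse inclusion \<open>ell1 \<subseteq> X\<close> holds in every Banach sequence space with
  normalised unit sequences (\<open>ell1_subset\<close>). Hence \<open>c \<noteq> 0\<close> forces \<open>X = ell1\<close>.
\<close>

definition truncate :: "nat set \<Rightarrow> (nat \<Rightarrow> 'a) \<Rightarrow> nat \<Rightarrow> 'a::real_normed_field"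
  where "truncate F x = (\<lambda>n. if n \<in> F then x n else 0)"

lemma truncate_empty: "truncate {} x = (\<lambda>n. 0)"
  by (simp add: truncate_def)

lemma truncate_insert:
  "k \<notin> F \<Longrightarrow> truncate (insert k F) x = (\<lambda>n. truncate F x n + x k * unit_seq k n)"
  by (auto simp: truncate_def unit_seq_def)

context banach_sequence_space
begin

lemma truncate_mem: "finite F \<Longrightarrow> truncate F x \<in> X"
  by (induction F rule: finite_induct)
    (auto simp: truncate_empty truncate_insert zero_mem intro!: add_mem scale_mem unit_seq_mem)

lemma norm_truncate_le: "finite F \<Longrightarrow> N (truncate F x) \<le> (\<Sum>n\<in>F. norm (x n))"
proof (induction F rule: finite_induct)
  case empty
  show ?case using norm_eq_zero_iff[OF zero_mem] by (simp add: truncate_empty)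
next
  case (insert k F)
  have "N (truncate (insert k F) x) \<le> N (truncate F x) + N (\<lambda>n. x k * unit_seq k n)"
    using insert.hyps
    by (simp add: truncate_insert norm_triangle truncate_mem scale_mem unit_seq_mem)
  also have "N (\<lambda>n. x k * unit_seq k n) = norm (x k)"
    by (simp add: norm_scale unit_seq_mem norm_unit_seq)
  finally show ?case using insert by simp
qed

text \<open>The sequence \<open>x k * unit_seq k\<close> is dominated by \<open>x\<close>, so convergence in norm implies
  convergence of every entry.\<close>
lemma norm_entry_le:
  assumes "x \<in> X" shows "norm (x k) \<le> N x"
proof -
  have "N (\<lambda>n. x k * unit_seq k n) \<le> N x"
    using assms by (rule solid_norm) (simp add: unit_seq_def)
  then show ?thesis by (simp add: norm_scale unit_seq_mem norm_unit_seq)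
qed

text \<open>The truncations of an absolutely summable sequence form a Cauchy sequence by the triangle
  inequality; completeness provides a limit, which is the original sequence because the
  coordinates are continuous.\<close>
lemma ell1_subset: "ell1 \<subseteq> X"
proof
  fix x :: "nat \<Rightarrow> 'a" assume "x \<in> ell1"
  then have sm: "summable (\<lambda>n. norm (x n))" by (simp add: ell1_def)
  let ?s = "\<lambda>i. truncate {..<i} x"
  have diff_le: "N (\<lambda>n. ?s i n - ?s j n) < e"
    if small: "\<And>m n. m \<ge> M \<Longrightarrow> norm (\<Sum>k=m..<n. norm (x k)) < e" and ij: "i \<ge> M" "j \<ge> M"
    for e M i j
  proof -
    let ?F = "{min i j..<max i j}"
    have "N (\<lambda>n. ?s i n - ?s j n) \<le> N (truncate ?F x)"
      by (rule solid_norm) (auto simp: truncate_mem, auto simp: truncate_def)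
    also have "\<dots> \<le> (\<Sum>k\<in>?F. norm (x k))" by (simp add: norm_truncate_le)
    also have "\<dots> < e" using small[of "min i j" "max i j"] ij by simp
    finally show ?thesis .
  qed
  have "\<exists>M. \<forall>i\<ge>M. \<forall>j\<ge>M. N (\<lambda>n. ?s i n - ?s j n) < e" if e: "e > 0" for e
  proof -
    obtain M where "\<And>m n. m \<ge> M \<Longrightarrow> norm (\<Sum>k=m..<n. norm (x k)) < e"
      using sm e unfolding summable_Cauchy by blast
    from diff_le[OF this] show ?thesis by blast
  qed
  then obtain l where l: "l \<in> X" and lim: "(\<lambda>i. N (\<lambda>n. ?s i n - l n)) \<longlonglongrightarrow> 0"
    using norm_complete[of ?s] truncate_mem by auto
  have "l k = x k" for k
  proof -
    have mem: "(\<lambda>n. ?s i n - l n) \<in> X" for i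
      using add_mem[OF truncate_mem scale_mem[OF l, of "-1"], of "{..<i}" x] by simp
    have "(\<lambda>i. ?s i k - l k) \<longlonglongrightarrow> 0"
      by (rule tendsto_0_le[OF lim, of _ 1])
        (simp add: order_trans[OF norm_entry_le[OF mem] abs_ge_self])
    moreover have "\<forall>\<^sub>F i in sequentially. ?s i k - l k = x k - l k"
      using eventually_gt_at_top[of k] by eventually_elim (simp add: truncate_def)
    ultimately have "(\<lambda>i. x k - l k) \<longlonglongrightarrow> 0" using tendsto_cong by fast
    then show ?thesis by (simp add: LIMSEQ_const_iff)
  qed
  then have "l = x" by (rule ext)
  with l show "x \<in> X" by simp
qed

lemma functional_truncate:
  assumes \<gamma>: "bounded_linear_functional_on X N \<gamma>" and "finite F"
  shows "\<gamma> (truncate F x) = (\<Sum>n\<in>F. x n * \<gamma> (unit_seq n))"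
  using \<open>finite F\<close>
proof (induction F rule: finite_induct)
  case empty
  have "\<gamma> (\<lambda>n. c * 0) = c * \<gamma> (\<lambda>n. 0)" for c
    using \<gamma> zero_mem unfolding bounded_linear_functional_on_def by fast
  from this[of 0] have "\<gamma> (\<lambda>n. 0) = 0" by simp
  then show ?case by (simp add: truncate_empty)
next
  case (insert k F)
  then show ?case using \<gamma>
    by (simp add: bounded_linear_functional_on_def truncate_insert truncate_mem scale_mem
        unit_seq_mem)
qed

text \<open>Evaluated on the truncated sequence of moduli, such a functional is a fixed nonzero multiple
  of a partial sum of \<open>norm (x n)\<close>, while the norm of that sequence never exceeds \<open>N x\<close>.\<close>
lemma subset_ell1:
  assumes \<gamma>: "bounded_linear_functional_on X N \<gamma>"
    and c: "\<And>n. \<gamma> (unit_seq n) = c" and "c \<noteq> 0"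
  shows "X \<subseteq> ell1"
proof
  fix x assume x: "x \<in> X"
  obtain C where C: "\<And>y. y \<in> X \<Longrightarrow> norm (\<gamma> y) \<le> N y * C"
    using \<gamma> unfolding bounded_linear_functional_on_def by blast
  have "(\<Sum>n<m. norm (x n)) \<le> N x * \<bar>C\<bar> / norm c" for m
  proof -
    let ?y = "truncate {..<m} (\<lambda>n. of_real (norm (x n)))"
    have y: "?y \<in> X" by (simp add: truncate_mem)
    have "\<gamma> ?y = of_real (\<Sum>n<m. norm (x n)) * c"
      by (simp add: functional_truncate[OF \<gamma>] c sum_distrib_right)
    then have "(\<Sum>n<m. norm (x n)) * norm c = norm (\<gamma> ?y)"
      by (simp only: norm_mult norm_of_real) (simp add: sum_nonneg)
    also have "\<dots> \<le> N ?y * \<bar>C\<bar>"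
      using C[OF y] mult_left_mono[OF abs_ge_self norm_nonneg[OF y], of C] by linarith
    also have "\<dots> \<le> N x * \<bar>C\<bar>"
      by (intro mult_right_mono solid_norm[OF x]) (auto simp: truncate_def)
    finally show ?thesis using \<open>c \<noteq> 0\<close> by (simp add: pos_le_divide_eq)
  qed
  then have "summable (\<lambda>n. norm (x n))"
    by (intro bounded_imp_summable[where B = "N x * \<bar>C\<bar> / norm c"])
      (simp_all only: norm_ge_zero flip: lessThan_Suc_atMost)
  then show "x \<in> ell1" by (simp add: ell1_def)
qed

lemma symmetric_functional_unit_seq_eq:
  assumes "symmetric_functional_on X \<gamma>"
  shows "\<gamma> (unit_seq m) = \<gamma> (unit_seq n)"
proof -
  have "(\<lambda>k. unit_seq m (transpose m n k)) = (unit_seq n :: nat \<Rightarrow> 'a)"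
    by (auto simp: unit_seq_def transpose_def)
  then show ?thesis
    using assms unit_seq_mem[of m] bij_transpose[of m n] unfolding symmetric_functional_on_def by fastforce
qed

theorem symmetric_functional_unit_seq_eq_0:
  assumes "X \<noteq> ell1" "bounded_linear_functional_on X N \<gamma>" "symmetric_functional_on X \<gamma>"
  shows "\<gamma> (unit_seq n) = 0"
proof (rule ccontr)
  assume "\<gamma> (unit_seq n) \<noteq> 0"
  with assms have "X \<subseteq> ell1"
    using subset_ell1 symmetric_functional_unit_seq_eq by blast
  with ell1_subset \<open>X \<noteq> ell1\<close> show False by blast
qed

end

theorem proposition3p1:
  "(\<forall>(X :: (nat \<Rightarrow> real) set) N \<gamma>.
      symmetric_banach_sequence_space X N \<and> X \<noteq> ell1 \<and>
      bounded_linear_functional_on X N \<gamma> \<and> symmetric_functional_on X \<gamma> \<longrightarrow>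
      (\<forall>n. \<gamma> (unit_seq n) = 0)) \<and>
   (\<forall>(X :: (nat \<Rightarrow> complex) set) N \<gamma>.
      symmetric_banach_sequence_space X N \<and> X \<noteq> ell1 \<and>
      bounded_linear_functional_on X N \<gamma> \<and> symmetric_functional_on X \<gamma> \<longrightarrow>
      (\<forall>n. \<gamma> (unit_seq n) = 0))"
  by (blast intro: symmetric_banach_sequence_space.axioms(1)
      banach_sequence_space.symmetric_functional_unit_seq_eq_0)

end
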